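(* Let $n>1$ be an integer, let $\alpha$ be a constant with $-1<\alpha\le \alpha_0:=\frac{n-1}{2}$, and let $R>0$ be a constant. Put $$q_0=q_0(\alpha,n)=\frac{n}{(n+1)/2+\alpha},\qquad p_0=q_0'=(1-1/q_0)^{-1}$$ (with $p_0=\infty$ if $q_0=1$). Then there is a constant $C(\alpha,R)$ (for the fixed dimension $n$; not depending on $p$, $q$, $r$, $f$) such that the following holds. Let $p>1$, $f\in L_p(\mathbb{R}^n)$, and let $q,r\ge 1$ satisfy $1+1/r=1/q+1/p$. Assume $q>q_0$, $r>r_0$ and $p\le p_0$, where $$r_0=r_0(\alpha,n;p):=\frac{p\,q_0}{p+q_0-p\,q_0}.$$ Define $$W(\alpha,n,R;p,r):=R^{\,n(1/p-1/r)}\,\bigl[q(p,r)-q_0(\alpha,n)\bigr]^{\,1/p-1-1/r},\qquad q(p,r)=\frac{pr}{pr+p-r}.$$ Then the Bochner-Riesz operator $B_R^{\alpha}$ satisfies $$\|B_R^{\alpha}[f]\|_r\le C(\alpha,R)\cdot W(\alpha,n,R;p,r)\cdot\|f\|_p .$$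
   Context: $\|\cdot\|_p$ is the usual norm of $L_p(\mathbb{R}^n)$ with respect to Lebesgue measure. The Bochner-Riesz operator of order $\alpha>-1$ and parameter $R>0$ is the Fourier multiplier operator with symbol $\left(1-|y|^2/R^2\right)_+^{\alpha}$, where $z_+=\max(z,0)$. It is represented as a convolution $$B_R^{\alpha}[f](t)=\int_{\mathbb{R}^n} f(t-s)\,K_\lambda^R(s)\,ds,\qquad K_\lambda^R(z)=C(\alpha)\,R^n\,\frac{J_\lambda(R|z|)}{|Rz|^{\lambda}},\qquad \lambda=\alpha+\frac n2,$$ with $C(\alpha)=1/\Gamma(\alpha+1)$, where $J_\lambda$ is the Bessel function of the first kind of order $\lambda$ and $\Gamma$ is the Gamma function. This convolution formula is taken as the definition of $B_R^\alpha$ on $L_p(\mathbb{R}^n)$. (The constant $C(\alpha,R)$ in the claim is a different constant from $C(\alpha)$.) *)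

theory Defs
  imports "HOL-Probability.Essential_Supremum"
begin

text \<open>Exponents range over \<^typ>\<open>ennreal\<close>, with the conventions $1/\infty = 0$ and $1/0 = \infty$.
  Functions on $\mathbb{R}^n$ are complex-valued functions on \<^typ>\<open>real ^ 'n\<close>, with $n = CARD('n)$.\<close>

definition Lp_space :: "ennreal \<Rightarrow> ((real ^ 'n) \<Rightarrow> complex) set" where
  "Lp_space p = {f. f \<in> borel_measurable lebesgue \<and>
     (if p = top then esssup lebesgue (\<lambda>x. ereal (norm (f x))) < \<infinity>
      else integrable lebesgue (\<lambda>x. norm (f x) powr enn2real p))}"

text \<open>Meaningful only for functions in \<^term>\<open>Lp_space p\<close>; outside it the value is arbitrary.\<close>

definition Lp_norm :: "ennreal \<Rightarrow> ((real ^ 'n) \<Rightarrow> complex) \<Rightarrow> real" where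
  "Lp_norm p f =
     (if p = top then real_of_ereal (esssup lebesgue (\<lambda>x. ereal (norm (f x))))
      else (LINT x|lebesgue. norm (f x) powr enn2real p) powr (1 / enn2real p))"

text \<open>Bessel function of the first kind, for real order and argument \<open>x \<ge> 0\<close>, by its power series
  $\sum_k (-1)^k / (k!\,\Gamma(k+\nu+1)) \cdot (x/2)^{2k+\nu}$.\<close>

definition Bessel_J :: "real \<Rightarrow> real \<Rightarrow> real" where
  "Bessel_J \<nu> x =
     (\<Sum>k. (-1) ^ k / fact k * rGamma (real k + \<nu> + 1) * (x / 2) powr (2 * real k + \<nu>))"

text \<open>At \<open>z = 0\<close> division by zero gives the value \<open>0\<close> instead of the continuous extension; this is
  a null set and does not affect the convolution.\<close>

definition BR_kernel :: "real \<Rightarrow> real \<Rightarrow> real ^ 'n \<Rightarrow> real" where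
  "BR_kernel \<alpha> R z =
     (let \<nu> = \<alpha> + real CARD('n) / 2
      in 1 / Gamma (\<alpha> + 1) * R ^ CARD('n) * (Bessel_J \<nu> (R * norm z) / norm (R *\<^sub>R z) powr \<nu>))"

definition BR_op :: "real \<Rightarrow> real \<Rightarrow> (real ^ 'n \<Rightarrow> complex) \<Rightarrow> real ^ 'n \<Rightarrow> complex" where
  "BR_op \<alpha> R f t = (LINT s|lebesgue. f (t - s) * complex_of_real (BR_kernel \<alpha> R s))"

definition q0_exp :: "real \<Rightarrow> nat \<Rightarrow> real" where
  "q0_exp \<alpha> n = real n / ((real n + 1) / 2 + \<alpha>)"

definition p0_exp :: "real \<Rightarrow> nat \<Rightarrow> ennreal" where
  "p0_exp \<alpha> n = (if q0_exp \<alpha> n = 1 then top else ennreal (1 / (1 - 1 / q0_exp \<alpha> n)))"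

text \<open>The denominator $p + q_0 - p q_0$ vanishes exactly at $p = p_0$, where the value is $\infty$.\<close>

definition r0_exp :: "real \<Rightarrow> nat \<Rightarrow> ennreal \<Rightarrow> ennreal" where
  "r0_exp \<alpha> n p =
     (let q\<^sub>0 = q0_exp \<alpha> n; p' = enn2real p
      in if p = p0_exp \<alpha> n then top else ennreal (p' * q\<^sub>0 / (p' + q\<^sub>0 - p' * q\<^sub>0)))"

text \<open>For \<open>r = \<infinity>\<close> the value is the limit $p/(p-1)$ of $pr/(pr+p-r)$. The case \<open>p = \<infinity>\<close> is
  irrelevant: $1 + 1/r = 1/q + 1/p$ would give \<open>q \<le> 1\<close>, contradicting $q > q_0 \ge 1$.\<close>

definition q_exp :: "ennreal \<Rightarrow> ennreal \<Rightarrow> real" where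
  "q_exp p r =
     (let p' = enn2real p; r' = enn2real r
      in if r = top then p' / (p' - 1) else p' * r' / (p' * r' + p' - r'))"

definition W_factor :: "real \<Rightarrow> nat \<Rightarrow> real \<Rightarrow> ennreal \<Rightarrow> ennreal \<Rightarrow> real" where
  "W_factor \<alpha> n R p r =
     R powr (real n * (enn2real (1 / p) - enn2real (1 / r))) *
     (q_exp p r - q0_exp \<alpha> n) powr (enn2real (1 / p) - 1 - enn2real (1 / r))"

end

theory Submission
  imports Defs
begin

text \<open>
  The kernel of the Bochner-Riesz operator lies in \<open>L_q\<close> for every \<open>q > q\<^sub>0\<close>, and the estimate is
  Young's convolution inequality with that \<open>q\<close>. The factor \<open>W\<close> is, up to a constant, a bound for the
  \<open>L_q\<close> norm of the kernel: since \<open>1/p - 1 - 1/r = -1/q\<close> and \<open>1/p - 1/r = 1 - 1/q\<close>, it equals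
  \<open>R powr (n (1 - 1/q)) * (q - q\<^sub>0) powr (-1/q)\<close>.

  Write \<open>\<nu> = \<alpha> + n/2\<close>. The function \<open>J\<^sub>\<nu>(x) / x powr \<nu>\<close> is bounded near 0 and decays like
  \<open>x powr -(\<nu> + 1/2)\<close>, where \<open>\<nu> + 1/2 = n/q\<^sub>0\<close>; this is \<open>Bessel_quotient_decay\<close>. It needs
  only \<open>J\<^sub>\<nu>(x) = O(1 / sqrt x)\<close> and none of the oscillatory asymptotics: \<open>u(x) = sqrt x * J\<^sub>\<nu>(x)\<close>
  satisfies \<open>u'' = (c/x\<^sup>2 - 1) u\<close> with \<open>c = \<nu>\<^sup>2 - 1/4\<close>, a perturbation of the harmonic oscillator
  that is integrable at infinity, so the oscillator energy \<open>u\<^sup>2 + u'\<^sup>2\<close> stays bounded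
  (\<open>Bessel_entire_decay\<close>). The differential equation is read off the power series.

  The kernel is therefore dominated by \<open>A R\<^sup>n (1 + R |z|) powr -(n/q\<^sub>0)\<close>. Its \<open>q\<close>-th power is integrable
  exactly for \<open>q > q\<^sub>0\<close>, and the integral blows up like \<open>1/(q - q\<^sub>0)\<close>; an explicit bound
  proportional to \<open>q/(q - q\<^sub>0)\<close>, with a constant independent of \<open>q\<close>, comes from
  \<open>nn_integral_one_plus_norm_powr_le\<close>. After taking \<open>q\<close>-th roots everything except
  the two powers that form \<open>W\<close> stays bounded uniformly in \<open>q \<ge> 1\<close> (\<open>BR_majorant_norm\<close>), which is
  what makes the final constant independent of all the exponents.

  Young's inequality (\<open>Young_Lp\<close>) is derived from Hoelder's inequality for three factors. All
  exponents enter through their reciprocals, so the case \<open>r = \<infinity>\<close> is the case of weight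
  \<open>1/r = 0\<close> and shares the pointwise estimate with finite \<open>r\<close>.
\<close>

section \<open>Decay of Bessel functions\<close>

definition Bessel_coeff :: "real \<Rightarrow> nat \<Rightarrow> real" where
  "Bessel_coeff \<nu> k = (-1) ^ k / fact k * rGamma (real k + \<nu> + 1)"

text \<open>The entire function \<open>G\<close> with \<open>J\<^sub>\<nu>(x) = (x/2) powr \<nu> * G(x\<^sup>2/4)\<close>; in hypergeometric notation it is
  \<open>0F1(\<nu> + 1; -y) / Gamma (\<nu> + 1)\<close>. Splitting off the power leaves a function that is smooth at 0.\<close>

definition Bessel_entire :: "real \<Rightarrow> real \<Rightarrow> real" where
  "Bessel_entire \<nu> y = (\<Sum>k. Bessel_coeff \<nu> k * y ^ k)"

text \<open>The functional equation of the Gamma function in coefficient form. Multiplied by \<open>y ^ k\<close> and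
  summed, it is the differential equation of \<open>Bessel_entire_ode\<close>.\<close>

lemma Bessel_coeff_Suc:
  "real (Suc k) * (real (Suc k) + \<nu>) * Bessel_coeff \<nu> (Suc k) = - Bessel_coeff \<nu> k"
proof -
  have *: "(real k + \<nu> + 1) * rGamma (real k + \<nu> + 1 + 1) = rGamma (real k + \<nu> + 1)"
    by (rule rGamma_plus1)
  have "real (Suc k) * (real (Suc k) + \<nu>) * Bessel_coeff \<nu> (Suc k)
      = real (Suc k) * ((-1) ^ Suc k / fact (Suc k)) * ((real k + \<nu> + 1) * rGamma (real k + \<nu> + 1 + 1))"
    by (simp add: Bessel_coeff_def add_ac mult_ac del: power_Suc fact_Suc)
  also have "\<dots> = real (Suc k) * ((-1) ^ Suc k / fact (Suc k)) * rGamma (real k + \<nu> + 1)"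
    by (simp only: *)
  also have "real (Suc k) * ((-1) ^ Suc k / fact (Suc k)) = - ((-1) ^ k / fact k :: real)"
    by (simp add: field_simps del: of_nat_Suc)
  finally show ?thesis by (simp add: Bessel_coeff_def)
qed

lemma abs_Bessel_coeff_le:
  assumes "\<nu> \<ge> 0"
  shows "\<bar>Bessel_coeff \<nu> k\<bar> \<le> \<bar>rGamma (\<nu> + 1)\<bar> / fact k"
proof (induction k)
  case 0
  then show ?case by (simp add: Bessel_coeff_def)
next
  case (Suc k)
  have "\<bar>Bessel_coeff \<nu> (Suc k)\<bar> * (real (Suc k) * 1)
      \<le> \<bar>Bessel_coeff \<nu> (Suc k)\<bar> * (real (Suc k) * (real (Suc k) + \<nu>))"
    using assms by (intro mult_left_mono) auto
  also have "\<dots> = \<bar>real (Suc k) * (real (Suc k) + \<nu>) * Bessel_coeff \<nu> (Suc k)\<bar>"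
    using assms by (simp add: abs_mult mult_ac)
  also have "\<dots> \<le> \<bar>rGamma (\<nu> + 1)\<bar> / fact k"
    unfolding Bessel_coeff_Suc using Suc by simp
  finally show ?case by (simp add: field_simps del: of_nat_Suc)
qed

lemma summable_Bessel_coeff:
  assumes "\<nu> \<ge> 0"
  shows "summable (\<lambda>k. Bessel_coeff \<nu> k * y ^ k)"
proof (rule summable_comparison_test')
  show "summable (\<lambda>k. \<bar>rGamma (\<nu> + 1)\<bar> * (inverse (fact k) * \<bar>y\<bar> ^ k))"
    by (intro summable_mult summable_exp)
  show "norm (Bessel_coeff \<nu> k * y ^ k) \<le> \<bar>rGamma (\<nu> + 1)\<bar> * (inverse (fact k) * \<bar>y\<bar> ^ k)" for k
    using mult_right_mono[OF abs_Bessel_coeff_le[OF assms, of k], of "\<bar>y\<bar> ^ k"]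
    by (simp add: abs_mult power_abs field_simps)
qed

lemma Bessel_J_eq_entire:
  assumes "\<nu> \<ge> 0" "x > 0"
  shows "Bessel_J \<nu> x = (x / 2) powr \<nu> * Bessel_entire \<nu> (x\<^sup>2 / 4)"
proof -
  have "(x / 2) powr (2 * real k + \<nu>) = (x / 2) powr \<nu> * (x\<^sup>2 / 4) ^ k" for k
  proof -
    have "(x / 2) powr (2 * real k + \<nu>) = (x / 2) powr (real (2 * k)) * (x / 2) powr \<nu>"
      by (simp add: powr_add)
    also have "(x / 2) powr (real (2 * k)) = (x / 2) ^ (2 * k)"
      using assms by (intro powr_realpow) simp
    also have "\<dots> = (x\<^sup>2 / 4) ^ k"
      by (simp add: power_mult power_divide)
    finally show ?thesis by simp
  qed
  then have "Bessel_J \<nu> x = (\<Sum>k. (x / 2) powr \<nu> * (Bessel_coeff \<nu> k * (x\<^sup>2 / 4) ^ k))"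
    unfolding Bessel_J_def Bessel_coeff_def by (simp add: mult_ac)
  also have "\<dots> = (x / 2) powr \<nu> * Bessel_entire \<nu> (x\<^sup>2 / 4)"
    unfolding Bessel_entire_def using summable_Bessel_coeff[OF assms(1)] by (rule suminf_mult)
  finally show ?thesis .
qed

text \<open>Bessel's differential equation in the variable \<open>y = x\<^sup>2/4\<close>.\<close>

lemma Bessel_entire_ode:
  assumes "\<nu> \<ge> 0"
  obtains G' G'' where "\<And>y. (Bessel_entire \<nu> has_real_derivative G' y) (at y)"
    and "\<And>y. (G' has_real_derivative G'' y) (at y)"
    and "\<And>y. y * G'' y + (\<nu> + 1) * G' y + Bessel_entire \<nu> y = 0"
proof -
  define a where "a = Bessel_coeff \<nu>"
  note S0 = summable_Bessel_coeff[OF assms, folded a_def]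
  have S1: "summable (\<lambda>k. diffs a k * y ^ k)" for y
    by (rule termdiff_converges_all[OF S0])
  have S2: "summable (\<lambda>k. diffs (diffs a) k * y ^ k)" for y
    by (rule termdiff_converges_all[OF S1])
  have "y * (\<Sum>k. diffs (diffs a) k * y ^ k) + (\<nu> + 1) * (\<Sum>k. diffs a k * y ^ k)
      + Bessel_entire \<nu> y = 0" for y
  proof -
    have "(\<lambda>k. diffs (diffs a) k * y ^ k) sums (\<Sum>k. diffs (diffs a) k * y ^ k)"
      using S2 by (rule summable_sums)
    then have "(\<lambda>k. y * (diffs (diffs a) k * y ^ k)) sums (y * (\<Sum>k. diffs (diffs a) k * y ^ k))"
      by (rule sums_mult)
    then have "(\<lambda>k. real (Suc k) * diffs a (Suc k) * y ^ Suc k) sums (y * (\<Sum>k. diffs (diffs a) k * y ^ k))"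
      by (simp add: diffs_def mult_ac)
    then have A: "(\<lambda>k. real k * diffs a k * y ^ k) sums (y * (\<Sum>k. diffs (diffs a) k * y ^ k))"
      using sums_Suc_iff[of "\<lambda>k. real k * diffs a k * y ^ k"] by simp
    have B: "(\<lambda>k. (\<nu> + 1) * (diffs a k * y ^ k)) sums ((\<nu> + 1) * (\<Sum>k. diffs a k * y ^ k))"
      by (intro sums_mult summable_sums S1)
    have C: "(\<lambda>k. a k * y ^ k) sums Bessel_entire \<nu> y"
      unfolding Bessel_entire_def a_def[symmetric] by (intro summable_sums S0)
    have "real k * diffs a k * y ^ k + (\<nu> + 1) * (diffs a k * y ^ k) + a k * y ^ k = 0" for k
    proof -
      have "real k * diffs a k + (\<nu> + 1) * diffs a k + a k = 0"
        using Bessel_coeff_Suc[of k \<nu>] by (simp add: diffs_def a_def algebra_simps)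
      then have "(real k * diffs a k + (\<nu> + 1) * diffs a k + a k) * y ^ k = 0" by simp
      then show ?thesis by (simp add: algebra_simps)
    qed
    then have "(\<lambda>k. 0) sums (y * (\<Sum>k. diffs (diffs a) k * y ^ k) + (\<nu> + 1) * (\<Sum>k. diffs a k * y ^ k)
      + Bessel_entire \<nu> y)"
      using sums_add[OF sums_add[OF A B] C] by simp
    then show ?thesis
      using sums_unique2 sums_zero by blast
  qed
  then show ?thesis
    using that[of "\<lambda>y. \<Sum>k. diffs a k * y ^ k" "\<lambda>y. \<Sum>k. diffs (diffs a) k * y ^ k"]
      termdiffs_strong_converges_everywhere[OF S0] termdiffs_strong_converges_everywhere[OF S1]
    unfolding Bessel_entire_def[abs_def] a_def[symmetric] by blast
qed

text \<open>The function \<open>u\<close> below is a constant multiple of \<open>sqrt x * J\<^sub>\<nu>(x)\<close>, the normal form of Bessel's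
  equation, in which the first-order term has disappeared. Along \<open>u'' = (c/x\<^sup>2 - 1) u\<close> the
  energy \<open>u\<^sup>2 + u'\<^sup>2\<close> has derivative \<open>2 c u u'/x\<^sup>2\<close>, at most \<open>\<bar>c\<bar>/x\<^sup>2\<close> times the energy itself. Multiplied by the
  integrating factor \<open>exp (\<bar>c\<bar>/x)\<close> it is nonincreasing, hence bounded by its value at 1.\<close>

lemma Bessel_entire_decay:
  assumes "\<nu> \<ge> 0"
  obtains M where "\<And>x. x \<ge> 1 \<Longrightarrow> x powr (\<nu> + 1 / 2) * \<bar>Bessel_entire \<nu> (x\<^sup>2 / 4)\<bar> \<le> M"
proof -
  obtain G' G'' where G': "\<And>y. (Bessel_entire \<nu> has_real_derivative G' y) (at y)"
    and G'': "\<And>y. (G' has_real_derivative G'' y) (at y)"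
    and ode: "\<And>y. y * G'' y + (\<nu> + 1) * G' y + Bessel_entire \<nu> y = 0"
    using Bessel_entire_ode[OF assms] by metis
  define G where "G = Bessel_entire \<nu>"
  define c where "c = \<nu>\<^sup>2 - 1 / 4"
  define u where "u x = x powr (\<nu> + 1 / 2) * G (x\<^sup>2 / 4)" for x
  define v where "v x = (\<nu> + 1 / 2) * x powr (\<nu> - 1 / 2) * G (x\<^sup>2 / 4)
    + x powr (\<nu> + 3 / 2) / 2 * G' (x\<^sup>2 / 4)" for x
  note [derivative_intros] = DERIV_chain2[OF G'[folded G_def]] DERIV_chain2[OF G'']
  have u': "(u has_real_derivative v x) (at x)" if "x > 0" for x
  proof -
    have "(u has_real_derivative ((\<nu> + 1 / 2) * x powr (\<nu> - 1 / 2) * G (x\<^sup>2 / 4)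
      + x powr (\<nu> + 1 / 2) * (x / 2) * G' (x\<^sup>2 / 4))) (at x)"
      unfolding u_def[abs_def] using that
      by (auto intro!: derivative_eq_intros simp: algebra_simps)
    moreover have "x powr (\<nu> + 3 / 2) = x powr (\<nu> + 1 / 2) * x"
      using that powr_add[of x "\<nu> + 1/2" 1] by (simp add: add.commute)
    ultimately show ?thesis by (simp add: v_def)
  qed
  have v': "(v has_real_derivative (c / x\<^sup>2 - 1) * u x) (at x)" if "x > 0" for x
  proof -
    have "(v has_real_derivative ((\<nu> + 1 / 2) * (\<nu> - 1 / 2) * x powr (\<nu> - 3 / 2) * G (x\<^sup>2 / 4)
      + ((\<nu> + 1 / 2) * x powr (\<nu> - 1 / 2) * (x / 2) + (\<nu> + 3 / 2) * x powr (\<nu> + 1 / 2) / 2) * G' (x\<^sup>2 / 4)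
      + x powr (\<nu> + 3 / 2) / 2 * (x / 2) * G'' (x\<^sup>2 / 4))) (at x)"
      unfolding v_def[abs_def] using that
      by (auto intro!: derivative_eq_intros simp: field_simps)
    also have "((\<nu> + 1 / 2) * (\<nu> - 1 / 2) * x powr (\<nu> - 3 / 2) * G (x\<^sup>2 / 4)
      + ((\<nu> + 1 / 2) * x powr (\<nu> - 1 / 2) * (x / 2) + (\<nu> + 3 / 2) * x powr (\<nu> + 1 / 2) / 2) * G' (x\<^sup>2 / 4)
      + x powr (\<nu> + 3 / 2) / 2 * (x / 2) * G'' (x\<^sup>2 / 4)) = (c / x\<^sup>2 - 1) * u x"
    proof -
      define w where "w = x powr (\<nu> + 1 / 2)"
      have p1: "x powr (\<nu> - 3 / 2) = w / x\<^sup>2"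
        using that powr_diff[of x "\<nu> + 1/2" 2] by (simp add: w_def)
      have p2: "x powr (\<nu> - 1 / 2) = w / x"
        using that powr_diff[of x "\<nu> + 1/2" 1] by (simp add: w_def)
      have p3: "x powr (\<nu> + 3 / 2) = w * x"
        using that powr_add[of x "\<nu> + 1/2" 1] by (simp add: w_def add.commute)
      have e: "x\<^sup>2 / 4 * G'' (x\<^sup>2 / 4) = - (\<nu> + 1) * G' (x\<^sup>2 / 4) - G (x\<^sup>2 / 4)"
        using ode[of "x\<^sup>2 / 4", folded G_def] by (simp add: algebra_simps)
      have "x powr (\<nu> + 3 / 2) / 2 * (x / 2) * G'' (x\<^sup>2 / 4) = w * (x\<^sup>2 / 4 * G'' (x\<^sup>2 / 4))"
        by (simp add: p3 power2_eq_square)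
      also have "\<dots> = w * (- (\<nu> + 1) * G' (x\<^sup>2 / 4) - G (x\<^sup>2 / 4))" by (simp only: e)
      finally have e': "x powr (\<nu> + 3 / 2) / 2 * (x / 2) * G'' (x\<^sup>2 / 4)
        = w * (- (\<nu> + 1) * G' (x\<^sup>2 / 4) - G (x\<^sup>2 / 4))" .
      show ?thesis
        using that unfolding e' p1 p2 u_def c_def w_def[symmetric]
        by (simp add: field_simps power2_eq_square)
    qed
    finally show ?thesis .
  qed
  define E where "E x = ((u x)\<^sup>2 + (v x)\<^sup>2) * exp (\<bar>c\<bar> / x)" for x
  have E': "(E has_real_derivative ((2 * u x * v x + 2 * v x * ((c / x\<^sup>2 - 1) * u x)) * exp (\<bar>c\<bar> / x)
    + ((u x)\<^sup>2 + (v x)\<^sup>2) * (exp (\<bar>c\<bar> / x) * (- \<bar>c\<bar> / x\<^sup>2)))) (at x)" if "x > 0" for x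
    unfolding E_def[abs_def] using that
    by (auto intro!: derivative_eq_intros u' v' simp: power2_eq_square field_simps)
  have nonpos: "(2 * u x * v x + 2 * v x * ((c / x\<^sup>2 - 1) * u x)) * exp (\<bar>c\<bar> / x)
    + ((u x)\<^sup>2 + (v x)\<^sup>2) * (exp (\<bar>c\<bar> / x) * (- \<bar>c\<bar> / x\<^sup>2)) \<le> 0" (is "?D \<le> 0") for x
  proof -
    have D: "?D = (c * (2 * u x * v x) - \<bar>c\<bar> * ((u x)\<^sup>2 + (v x)\<^sup>2)) * (exp (\<bar>c\<bar> / x) / x\<^sup>2)"
      by (simp add: algebra_simps diff_divide_distrib add_divide_distrib)
    have "c * (2 * u x * v x) \<le> \<bar>c\<bar> * ((u x)\<^sup>2 + (v x)\<^sup>2)"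
    proof -
      have "c * (2 * u x * v x) \<le> \<bar>c\<bar> * \<bar>2 * u x * v x\<bar>"
        by (metis abs_ge_self abs_mult)
      also have "\<bar>2 * u x * v x\<bar> \<le> (u x)\<^sup>2 + (v x)\<^sup>2"
        using sum_squares_bound[of "u x" "v x"] sum_squares_bound[of "- u x" "v x"]
        by (simp add: abs_le_iff)
      finally show ?thesis by (simp add: mult_left_mono)
    qed
    then show ?thesis unfolding D by (intro mult_nonpos_nonneg) auto
  qed
  have E_le: "E x \<le> E 1" if "x \<ge> 1" for x
  proof (rule DERIV_nonpos_imp_nonincreasing[OF that])
    fix t :: real assume "1 \<le> t"
    then have "t > 0" by simp
    from E'[OF this] nonpos[of t] show "\<exists>y. (E has_real_derivative y) (at t) \<and> y \<le> 0"
      by blast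
  qed
  show ?thesis
  proof
    fix x :: real assume x: "x \<ge> 1"
    have "(u x)\<^sup>2 \<le> ((u x)\<^sup>2 + (v x)\<^sup>2) * 1" by simp
    also have "\<dots> \<le> E x" unfolding E_def using x by (intro mult_left_mono) auto
    also have "\<dots> \<le> E 1" using E_le x .
    finally have "\<bar>u x\<bar> \<le> sqrt (E 1)" using real_sqrt_le_mono by fastforce
    then show "x powr (\<nu> + 1 / 2) * \<bar>Bessel_entire \<nu> (x\<^sup>2 / 4)\<bar> \<le> sqrt (E 1)"
      by (simp add: u_def G_def abs_mult)
  qed
qed

lemma continuous_on_Bessel_entire:
  assumes "\<nu> \<ge> 0"
  shows "continuous_on A (Bessel_entire \<nu>)"
proof -
  obtain G' where "\<And>y. (Bessel_entire \<nu> has_real_derivative G' y) (at y)"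
    using Bessel_entire_ode[OF assms] by metis
  then show ?thesis
    using DERIV_isCont continuous_at_imp_continuous_on by blast
qed

lemma Bessel_quotient_eq:
  assumes "\<nu> \<ge> 0" "x > 0"
  shows "Bessel_J \<nu> x / x powr \<nu> = (1 / 2) powr \<nu> * Bessel_entire \<nu> (x\<^sup>2 / 4)"
proof -
  have "(x / 2) powr \<nu> = x powr \<nu> * (1 / 2) powr \<nu>"
    using assms powr_mult[of x "1/2" \<nu>] by simp
  then show ?thesis
    using assms by (simp add: Bessel_J_eq_entire)
qed

text \<open>Continuity of the entire factor gives the bound on \<open>(0, 1]\<close>, the energy estimate the bound on
  \<open>[1, \<infinity>)\<close>; there \<open>1 + x \<le> 2 x\<close> turns powers of \<open>x\<close> into powers of \<open>1 + x\<close>.\<close>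

lemma Bessel_quotient_decay:
  assumes "\<nu> \<ge> 0"
  obtains M where "M > 0"
    and "\<And>x. x > 0 \<Longrightarrow> \<bar>Bessel_J \<nu> x / x powr \<nu>\<bar> \<le> M * (1 + x) powr - (\<nu> + 1 / 2)"
proof -
  define s where "s = \<nu> + 1 / 2"
  have s: "s > 0" using assms by (simp add: s_def)
  obtain M1 where M1: "\<And>x. x \<ge> 1 \<Longrightarrow> x powr s * \<bar>Bessel_entire \<nu> (x\<^sup>2 / 4)\<bar> \<le> M1"
    using Bessel_entire_decay[OF assms] unfolding s_def by metis
  have "compact (Bessel_entire \<nu> ` {0..1})"
    by (intro compact_continuous_image continuous_on_Bessel_entire assms compact_Icc)
  then obtain M0 where M0: "\<And>y. y \<in> {0..1} \<Longrightarrow> \<bar>Bessel_entire \<nu> y\<bar> \<le> M0"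
    by (force dest!: compact_imp_bounded simp: bounded_iff)
  define M where "M = max 1 (max M0 M1)"
  have *: "\<bar>Bessel_entire \<nu> (x\<^sup>2 / 4)\<bar> \<le> 2 powr s * M * (1 + x) powr - s" if "x > 0" for x
  proof (cases "x \<le> 1")
    case True
    have "x\<^sup>2 \<le> 1" using True that by (simp add: power_le_one)
    then have "\<bar>Bessel_entire \<nu> (x\<^sup>2 / 4)\<bar> \<le> M"
      using M0[of "x\<^sup>2 / 4"] by (simp add: M_def)
    also have "(1 + x) powr s \<le> 2 powr s"
      using True that s by (intro powr_mono2) auto
    then have "M * 1 \<le> M * (2 powr s * (1 + x) powr - s)"
      using that by (intro mult_left_mono) (auto simp: powr_minus field_simps M_def)
    finally show ?thesis by (simp add: mult_ac)
  next
    case False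
    have "(1 + x) powr s \<le> (2 * x) powr s"
      using False s by (intro powr_mono2) auto
    then have "(1 + x) powr s * \<bar>Bessel_entire \<nu> (x\<^sup>2 / 4)\<bar>
        \<le> (2 * x) powr s * \<bar>Bessel_entire \<nu> (x\<^sup>2 / 4)\<bar>"
      by (rule mult_right_mono) simp
    also have "\<dots> = 2 powr s * (x powr s * \<bar>Bessel_entire \<nu> (x\<^sup>2 / 4)\<bar>)"
      using that by (simp add: powr_mult)
    also have "\<dots> \<le> 2 powr s * M"
      using M1[of x] False by (intro mult_left_mono) (auto simp: M_def)
    finally show ?thesis
      using that by (simp add: powr_minus field_simps)
  qed
  show ?thesis
  proof (rule that[of "(1 / 2) powr \<nu> * (2 powr s * M)"])
    show "(1 / 2) powr \<nu> * (2 powr s * M) > 0" by (simp add: M_def)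
    show "\<bar>Bessel_J \<nu> x / x powr \<nu>\<bar> \<le> (1 / 2) powr \<nu> * (2 powr s * M) * (1 + x) powr - (\<nu> + 1 / 2)"
      if "x > 0" for x
      unfolding Bessel_quotient_eq[OF assms that] s_def[symmetric] abs_mult mult.assoc
      using *[OF that] by (simp add: mult_ac)
  qed
qed

section \<open>A radial majorant of the kernel and its norm\<close>

text \<open>The factor \<open>A\<close> does not depend on \<open>R\<close>, because \<open>R\<close> enters the kernel only by dilation.\<close>

lemma BR_kernel_majorant:
  fixes \<alpha> :: real
  assumes "-1 < \<alpha>" and "0 \<le> \<alpha> + real CARD('n::finite) / 2"
  obtains A where "A > 0" and "\<And>R (z :: real ^ 'n). R > 0 \<Longrightarrow>
    \<bar>BR_kernel \<alpha> R z\<bar> \<le> A * R ^ CARD('n) * (1 + R * norm z) powr - (\<alpha> + (real CARD('n) + 1) / 2)"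
proof -
  define \<nu> where "\<nu> = \<alpha> + real CARD('n) / 2"
  have \<nu>: "\<alpha> + (real CARD('n) + 1) / 2 = \<nu> + 1 / 2" by (simp add: \<nu>_def)
  obtain M where M: "M > 0"
    "\<And>x. x > 0 \<Longrightarrow> \<bar>Bessel_J \<nu> x / x powr \<nu>\<bar> \<le> M * (1 + x) powr - (\<nu> + 1 / 2)"
    by (rule Bessel_quotient_decay[of \<nu>]) (use assms(2) in \<open>auto simp: \<nu>_def\<close>)
  have G: "Gamma (\<alpha> + 1) > 0" using assms by (intro Gamma_real_pos) simp
  show ?thesis
  proof (rule that[of "M / Gamma (\<alpha> + 1)"])
    show "M / Gamma (\<alpha> + 1) > 0" using M G by simp
    fix R :: real and z :: "real ^ 'n" assume R: "R > 0"
    show "\<bar>BR_kernel \<alpha> R z\<bar> \<le> M / Gamma (\<alpha> + 1) * R ^ CARD('n)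
      * (1 + R * norm z) powr - (\<alpha> + (real CARD('n) + 1) / 2)"
    proof (cases "z = 0")
      case True
      then show ?thesis using R M(1) G by (simp add: BR_kernel_def Let_def)
    next
      case False
      have "\<bar>BR_kernel \<alpha> R z\<bar> = 1 / Gamma (\<alpha> + 1) * R ^ CARD('n)
          * \<bar>Bessel_J \<nu> (R * norm z) / (R * norm z) powr \<nu>\<bar>"
        using R G unfolding BR_kernel_def Let_def \<nu>_def[symmetric] abs_mult by simp
      also have "\<dots> \<le> 1 / Gamma (\<alpha> + 1) * R ^ CARD('n)
          * (M * (1 + R * norm z) powr - (\<nu> + 1 / 2))"
        using R G False by (intro mult_left_mono M(2)) auto
      finally show ?thesis by (simp add: \<nu> mult_ac)
    qed
  qed
qed

lemma borel_measurable_BR_kernel: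
  assumes "0 \<le> \<alpha> + real CARD('n::finite) / 2" "R > 0"
  shows "(BR_kernel \<alpha> R :: real ^ 'n \<Rightarrow> real) \<in> borel_measurable borel"
proof -
  define \<nu> where "\<nu> = \<alpha> + real CARD('n) / 2"
  have "continuous_on UNIV (\<lambda>z :: real ^ 'n. Bessel_entire \<nu> ((R * norm z)\<^sup>2 / 4))"
    using assms by (intro continuous_on_compose2[OF continuous_on_Bessel_entire[of \<nu> UNIV]] continuous_intros)
      (auto simp: \<nu>_def)
  then have G: "(\<lambda>z :: real ^ 'n. Bessel_entire \<nu> ((R * norm z)\<^sup>2 / 4)) \<in> borel_measurable borel"
    by (rule borel_measurable_continuous_onI)
  have "BR_kernel \<alpha> R = (\<lambda>z :: real ^ 'n. if z = 0 then 0 else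
      1 / Gamma (\<alpha> + 1) * R ^ CARD('n) * ((1 / 2) powr \<nu> * Bessel_entire \<nu> ((R * norm z)\<^sup>2 / 4)))"
  proof
    fix z :: "real ^ 'n"
    show "BR_kernel \<alpha> R z = (if z = 0 then 0 else
      1 / Gamma (\<alpha> + 1) * R ^ CARD('n) * ((1 / 2) powr \<nu> * Bessel_entire \<nu> ((R * norm z)\<^sup>2 / 4)))"
    proof (cases "z = 0")
      case True
      then show ?thesis by (simp only: BR_kernel_def Let_def norm_zero scaleR_zero_right if_True) simp
    next
      case False
      then have "Bessel_J \<nu> (R * norm z) / (R * norm z) powr \<nu>
          = (1 / 2) powr \<nu> * Bessel_entire \<nu> ((R * norm z)\<^sup>2 / 4)"
        using assms by (intro Bessel_quotient_eq) (simp_all add: \<nu>_def)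
      moreover have "norm (R *\<^sub>R z) = R * norm z"
        using assms by simp
      ultimately show ?thesis
        using False unfolding BR_kernel_def Let_def \<nu>_def[symmetric] by simp
    qed
  qed
  also have "\<dots> \<in> borel_measurable borel"
    by (intro measurable_If borel_measurable_times borel_measurable_const G) simp
  finally show ?thesis .
qed

text \<open>The layer-cake representation of a negative power, through which the next lemma reduces
  an integral over space to volumes of balls.\<close>

lemma powr_eq_tail_integral:
  fixes a s :: real
  assumes "a > 0" "s > 0"
  shows "(\<integral>\<^sup>+u. ennreal (s * u powr - (s + 1)) * indicator {a..} u \<partial>lborel) = ennreal (a powr - s)"
proof -
  have "(\<integral>\<^sup>+u. ennreal (s * u powr - (s + 1)) * indicator {a..} u \<partial>lborel)
      = ennreal (0 - (- (a powr - s)))"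
  proof (rule nn_integral_FTC_atLeast)
    show "((\<lambda>u. - (u powr - s)) has_real_derivative s * x powr - (s + 1)) (at x)" if "a \<le> x" for x
    proof -
      have "((\<lambda>u. - (u powr - s)) has_real_derivative - (- s * x powr (- s - 1))) (at x)"
        using assms that by (intro DERIV_minus has_real_derivative_powr) simp
      moreover have "- (s + 1) = - s - 1" by simp
      ultimately show ?thesis by (metis minus_mult_left minus_minus)
    qed
    have "((\<lambda>u. u powr - s) \<longlongrightarrow> 0) at_top"
      using assms by (intro tendsto_neg_powr filterlim_ident) simp
    then show "((\<lambda>u. - (u powr - s)) \<longlongrightarrow> 0) at_top"
      using tendsto_minus by fastforce
    show "(\<lambda>u. s * u powr - (s + 1)) \<in> borel_measurable borel"
      by measurable
    show "0 \<le> s * x powr - (s + 1)" if "a \<le> x" for x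
      using assms by simp
  qed
  then show ?thesis by simp
qed

text \<open>By the layer-cake formula the integral becomes an integral over levels \<open>u \<ge> 1\<close> of the volume of
  the ball where \<open>1 + R |z| \<le> u\<close>. Enlarging the radius \<open>(u - 1)/R\<close> to \<open>u/R\<close> leaves a pure
  power of \<open>u\<close> and keeps the order \<open>1/(s - n)\<close> of the singularity, which comes from large \<open>u\<close>;
  here \<open>n\<close> is the dimension.\<close>

lemma nn_integral_one_plus_norm_powr_le:
  fixes R s :: real
  assumes R: "R > 0" and s: "s > DIM('a::euclidean_space)"
  shows "(\<integral>\<^sup>+z. ennreal ((1 + R * norm (z :: 'a)) powr - s) \<partial>lborel)
    \<le> ennreal (unit_ball_vol DIM('a) * s / (s - DIM('a)) / R ^ DIM('a))"
proof -
  define n where "n = real DIM('a)"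
  have n: "n \<ge> 0" "s > n" using s by (auto simp: n_def)
  have "(\<integral>\<^sup>+z. ennreal ((1 + R * norm (z :: 'a)) powr - s) \<partial>lborel)
      = (\<integral>\<^sup>+z. (\<integral>\<^sup>+u. ennreal (s * u powr - (s + 1)) * indicator {1 + R * norm z..} u \<partial>lborel) \<partial>(lborel :: 'a measure))"
    using n R by (intro nn_integral_cong powr_eq_tail_integral[symmetric]) (auto intro: add_pos_nonneg)
  also have "\<dots> = (\<integral>\<^sup>+u. (\<integral>\<^sup>+z. ennreal (s * u powr - (s + 1)) * indicator {1 + R * norm z..} u \<partial>(lborel :: 'a measure)) \<partial>lborel)"
  proof (rule lborel_pair.Fubini'[symmetric, where
        f = "\<lambda>(z :: 'a) u. ennreal (s * u powr - (s + 1)) * indicator {1 + R * norm z..} u"])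
    have "{p \<in> space ((lborel :: 'a measure) \<Otimes>\<^sub>M (lborel :: real measure)). 1 + R * norm (fst p) \<le> snd p}
        \<in> sets (lborel \<Otimes>\<^sub>M lborel)"
      by measurable
    then have "{p :: 'a \<times> real. 1 + R * norm (fst p) \<le> snd p} \<in> sets (lborel \<Otimes>\<^sub>M lborel)"
      by (simp add: space_pair_measure)
    then have [measurable]: "(\<lambda>p :: 'a \<times> real. indicator {p. 1 + R * norm (fst p) \<le> snd p} p :: ennreal)
        \<in> borel_measurable (lborel \<Otimes>\<^sub>M lborel)"
      by simp
    have "(\<lambda>p :: 'a \<times> real. ennreal (s * snd p powr - (s + 1)) * indicator {p. 1 + R * norm (fst p) \<le> snd p} p)
      \<in> borel_measurable (lborel \<Otimes>\<^sub>M lborel)"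
      by measurable
    then show "(\<lambda>(x :: 'a, y). ennreal (s * y powr - (s + 1)) * indicator {1 + R * norm x..} y)
      \<in> borel_measurable (lborel \<Otimes>\<^sub>M lborel)"
      by (simp add: case_prod_beta' indicator_def)
  qed
  also have "\<dots> \<le> (\<integral>\<^sup>+u. ennreal (unit_ball_vol n / R ^ DIM('a) * s / (s - n)) *
      (ennreal ((s - n) * u powr - (s - n + 1)) * indicator {1..} u) \<partial>lborel)"
  proof (intro nn_integral_mono)
    fix u :: real
    show "(\<integral>\<^sup>+z. ennreal (s * u powr - (s + 1)) * indicator {1 + R * norm z..} u \<partial>(lborel :: 'a measure))
      \<le> ennreal (unit_ball_vol n / R ^ DIM('a) * s / (s - n)) *
        (ennreal ((s - n) * u powr - (s - n + 1)) * indicator {1..} u)"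
    proof (cases "u \<ge> 1")
      case False
      then have "indicator {1 + R * norm z..} u = (0 :: ennreal)" for z :: 'a
        using R by (auto simp: indicator_def not_le add.commute intro: add_pos_nonneg less_le_trans)
      then show ?thesis by simp
    next
      case True
      have "indicator {1 + R * norm z..} u = (indicator (cball 0 ((u - 1) / R)) z :: ennreal)" for z :: 'a
        using R by (auto simp: indicator_def field_simps)
      then have "(\<integral>\<^sup>+z. ennreal (s * u powr - (s + 1)) * indicator {1 + R * norm z..} u \<partial>(lborel :: 'a measure))
          = ennreal (s * u powr - (s + 1)) * ennreal (unit_ball_vol n * ((u - 1) / R) ^ DIM('a))"
        using True R by (simp add: nn_integral_cmult_indicator emeasure_cball n_def)
      also have "\<dots> \<le> ennreal (s * u powr - (s + 1)) * ennreal (unit_ball_vol n * (u / R) ^ DIM('a))"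
        using True R n by (intro mult_left_mono ennreal_leI power_mono divide_right_mono) auto
      also have "\<dots> = ennreal (s * u powr - (s + 1) * (unit_ball_vol n * (u / R) ^ DIM('a)))"
        using n by (simp add: ennreal_mult')
      also have "s * u powr - (s + 1) * (unit_ball_vol n * (u / R) ^ DIM('a))
          = (unit_ball_vol n / R ^ DIM('a) * s / (s - n)) * ((s - n) * u powr - (s - n + 1))"
      proof -
        have "u ^ DIM('a) = u powr n" using True by (simp add: n_def powr_realpow)
        then have "u powr - (s + 1) * u ^ DIM('a) = u powr - (s - n + 1)"
          by (simp add: algebra_simps flip: powr_add)
        then have "s * u powr - (s + 1) * (unit_ball_vol n * (u / R) ^ DIM('a))
            = unit_ball_vol n / R ^ DIM('a) * s * u powr - (s - n + 1)"
          by (simp add: power_divide mult_ac)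
        then show ?thesis using n by simp
      qed
      also have "ennreal \<dots> = ennreal (unit_ball_vol n / R ^ DIM('a) * s / (s - n)) *
        (ennreal ((s - n) * u powr - (s - n + 1)) * indicator {1..} u)"
        using True n R by (subst ennreal_mult') auto
      finally show ?thesis .
    qed
  qed
  also have "\<dots> = ennreal (unit_ball_vol n / R ^ DIM('a) * s / (s - n)) *
     (\<integral>\<^sup>+u. ennreal ((s - n) * u powr - (s - n + 1)) * indicator {1..} u \<partial>lborel)"
    by (intro nn_integral_cmult) auto
  also have "(\<integral>\<^sup>+u. ennreal ((s - n) * u powr - (s - n + 1)) * indicator {1..} u \<partial>lborel) = 1"
    using n by (subst powr_eq_tail_integral) auto
  finally show ?thesis by (simp add: n_def mult_ac)
qed

text \<open>The \<open>q\<close>-th power of \<open>v\<close> decays with exponent \<open>s = n q/q\<^sub>0 > n\<close>, and \<open>s/(s - n) = q/(q - q\<^sub>0)\<close>. In the \<open>q\<close>-th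
  root the factors \<open>\<omega> powr (1/q)\<close> and \<open>q powr (1/q)\<close> are at most \<open>max 1 \<omega>\<close> and \<open>exp 1\<close>, uniformly
  in \<open>q \<ge> 1\<close>.\<close>

lemma BR_majorant_norm:
  fixes A R q q\<^sub>0 :: real
  assumes A: "A > 0" and R: "R > 0" and q: "q > q\<^sub>0" "q\<^sub>0 \<ge> 1"
  defines "v \<equiv> \<lambda>z :: real ^ 'n. A * R ^ CARD('n) * (1 + R * norm z) powr - (real CARD('n) / q\<^sub>0)"
  shows "integrable lborel (\<lambda>z. v z powr q)"
    and "(LINT z|lborel. v z powr q) powr (1 / q)
      \<le> A * max 1 (unit_ball_vol CARD('n)) * exp 1 * R powr (CARD('n) * (1 - 1 / q)) * (q - q\<^sub>0) powr - (1 / q)"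
proof -
  define n where "n = real CARD('n)"
  have n: "n > 0" by (simp add: n_def)
  define s where "s = n * q / q\<^sub>0"
  have s: "s > n" using q n by (simp add: s_def field_simps)
  define \<omega> where "\<omega> = unit_ball_vol n"
  have \<omega>: "\<omega> > 0" using n by (simp add: \<omega>_def)
  define w where "w z = (1 + R * norm z) powr - s" for z :: "real ^ 'n"
  have vw: "v z powr q = (A * R powr n) powr q * w z" for z
  proof -
    have "R ^ CARD('n) = R powr n" using R by (simp add: n_def powr_realpow)
    then show ?thesis
      using A R by (simp add: v_def w_def s_def powr_mult powr_powr n_def)
  qed
  have le: "(\<integral>\<^sup>+z. ennreal (w z) \<partial>lborel) \<le> ennreal (\<omega> * s / (s - n) / R powr n)"
    using nn_integral_one_plus_norm_powr_le[OF R, of s, where 'a = "real ^ 'n"] s R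
    by (simp add: w_def n_def \<omega>_def powr_realpow)
  have [measurable]: "w \<in> borel_measurable borel" unfolding w_def[abs_def] by measurable
  have w0: "w z \<ge> 0" for z by (simp add: w_def)
  have w_int: "integrable lborel w"
    using le w0 by (intro integrableI_nonneg) (auto intro: order_le_less_trans)
  then show "integrable lborel (\<lambda>z. v z powr q)"
    unfolding vw by simp
  have "ennreal (LINT z|lborel. w z) \<le> ennreal (\<omega> * s / (s - n) / R powr n)"
    using le w0 w_int by (subst nn_integral_eq_integral[symmetric]) auto
  then have w_le: "(LINT z|lborel. w z) \<le> \<omega> * s / (s - n) / R powr n"
    using \<omega> s n by (subst (asm) ennreal_le_iff) auto
  have "s / (s - n) = q / (q - q\<^sub>0)"
    using q n by (simp add: s_def field_simps)
  then have "\<omega> * s / (s - n) / R powr n = \<omega> * q / (q - q\<^sub>0) / R powr n"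
    by (metis times_divide_eq_right)
  with w_le have w_le': "(LINT z|lborel. w z) \<le> \<omega> * q / (q - q\<^sub>0) / R powr n" by simp
  have "(LINT z|lborel. v z powr q) powr (1 / q) = ((A * R powr n) powr q * (LINT z|lborel. w z)) powr (1 / q)"
    unfolding vw by simp
  also have "\<dots> \<le> ((A * R powr n) powr q * (\<omega> * q / (q - q\<^sub>0) / R powr n)) powr (1 / q)"
    using w_le' w0 q by (intro powr_mono2 mult_left_mono mult_nonneg_nonneg Bochner_Integration.integral_nonneg) auto
  also have "\<dots> = A * \<omega> powr (1 / q) * q powr (1 / q) * (R powr n * R powr - (n / q)) * (q - q\<^sub>0) powr - (1 / q)"
  proof -
    have a: "((A * R powr n) powr q) powr (1 / q) = A * R powr n"
      using A R q by (simp add: powr_powr)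
    have b: "(\<omega> * q / (q - q\<^sub>0) / R powr n) powr (1 / q)
        = \<omega> powr (1 / q) * q powr (1 / q) / (q - q\<^sub>0) powr (1 / q) / R powr (n / q)"
      using \<omega> q R by (simp add: powr_mult powr_divide powr_powr)
    have c: "((A * R powr n) powr q * (\<omega> * q / (q - q\<^sub>0) / R powr n)) powr (1 / q)
        = ((A * R powr n) powr q) powr (1 / q) * (\<omega> * q / (q - q\<^sub>0) / R powr n) powr (1 / q)"
      by (rule powr_mult)
    show ?thesis
      unfolding c a b by (simp add: powr_minus_divide mult_ac)
  qed
  also have "R powr n * R powr - (n / q) = R powr (n * (1 - 1 / q))"
    by (simp add: algebra_simps flip: powr_add)
  also have "A * \<omega> powr (1 / q) * q powr (1 / q) * R powr (n * (1 - 1 / q)) * (q - q\<^sub>0) powr - (1 / q)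
    \<le> A * max 1 \<omega> * exp 1 * R powr (n * (1 - 1 / q)) * (q - q\<^sub>0) powr - (1 / q)"
  proof (intro mult_right_mono mult_mono mult_left_mono)
    have "\<omega> powr (1 / q) \<le> max 1 \<omega> powr (1 / q)"
      using \<omega> q by (intro powr_mono2) auto
    also have "\<dots> \<le> max 1 \<omega> powr 1"
      using q by (intro powr_mono) auto
    finally show "\<omega> powr (1 / q) \<le> max 1 \<omega>" by simp
    have "ln q \<le> q" using q ln_le_minus_one[of q] by simp
    then have "1 / q * ln q \<le> 1" using q by (simp add: field_simps)
    then show "q powr (1 / q) \<le> exp 1" using q by (simp add: powr_def)
  qed (use A \<omega> in auto)
  finally show "(LINT z|lborel. v z powr q) powr (1 / q)
      \<le> A * max 1 (unit_ball_vol CARD('n)) * exp 1 * R powr (CARD('n) * (1 - 1 / q)) * (q - q\<^sub>0) powr - (1 / q)"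
    by (simp add: \<omega>_def n_def)
qed

section \<open>The inequalities of Hoelder and Young\<close>

text \<open>With \<open>G\<close> the geometric mean, \<open>exp t \<ge> 1 + t\<close> at \<open>t = ln (x i / G)\<close> gives
  \<open>x i / G \<ge> 1 + ln (x i) - ln G\<close>; averaging with the weights makes the logarithms cancel.\<close>

lemma weighted_arith_geo_mean:
  fixes x \<theta> :: "'i \<Rightarrow> real"
  assumes I: "finite I" "\<And>i. i \<in> I \<Longrightarrow> 0 \<le> x i" "\<And>i. i \<in> I \<Longrightarrow> 0 \<le> \<theta> i" "(\<Sum>i\<in>I. \<theta> i) = 1"
  shows "(\<Prod>i\<in>I. x i powr \<theta> i) \<le> (\<Sum>i\<in>I. \<theta> i * x i)"
proof (cases "\<exists>i\<in>I. x i = 0")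
  case True
  then have "(\<Prod>i\<in>I. x i powr \<theta> i) = 0" using I(1) by auto
  moreover have "0 \<le> (\<Sum>i\<in>I. \<theta> i * x i)"
    by (intro sum_nonneg mult_nonneg_nonneg I)
  ultimately show ?thesis by simp
next
  case False
  then have pos: "x i > 0" if "i \<in> I" for i using I(2) that by fastforce
  define L where "L = (\<Sum>i\<in>I. \<theta> i * ln (x i))"
  have G: "(\<Prod>i\<in>I. x i powr \<theta> i) = exp L"
    unfolding L_def exp_sum[OF I(1)] using False by (intro prod.cong) (auto simp: powr_def)
  have "\<theta> i * (1 + (ln (x i) - L)) \<le> \<theta> i * (x i / exp L)" if "i \<in> I" for i
  proof (intro mult_left_mono I(3) that)
    have "1 + (ln (x i) - L) \<le> exp (ln (x i) - L)" by (rule exp_ge_add_one_self)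
    then show "1 + (ln (x i) - L) \<le> x i / exp L" using pos[OF that] by (simp add: exp_diff)
  qed
  then have "(\<Sum>i\<in>I. \<theta> i * (1 + (ln (x i) - L))) \<le> (\<Sum>i\<in>I. \<theta> i * (x i / exp L))"
    by (rule sum_mono)
  moreover have "(\<Sum>i\<in>I. \<theta> i * (1 + (ln (x i) - L))) = (1 - L) * (\<Sum>i\<in>I. \<theta> i) + L"
    unfolding L_def sum_distrib_left by (simp add: algebra_simps sum.distrib sum_subtractf flip: L_def)
  moreover have "(\<Sum>i\<in>I. \<theta> i * (x i / exp L)) = (\<Sum>i\<in>I. \<theta> i * x i) / exp L"
    by (simp add: sum_divide_distrib)
  ultimately have "1 \<le> (\<Sum>i\<in>I. \<theta> i * x i) / exp L" using I(4) by simp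
  then show ?thesis unfolding G by (simp add: field_simps)
qed

text \<open>Normalising every \<open>f i\<close> to integral 1 reduces the inequality to the pointwise
  arithmetic-geometric mean inequality. A weight 0 is allowed; as \<open>0 powr 0 = 0\<close>, the factor
  \<open>f i x powr 0\<close> is then the indicator function of the support of \<open>f i\<close>, not the constant 1.\<close>

lemma Hoelder_finite_family:
  fixes f :: "'i \<Rightarrow> 'a \<Rightarrow> real"
  assumes I: "finite I" "\<And>i. i \<in> I \<Longrightarrow> 0 \<le> \<theta> i" "(\<Sum>i\<in>I. \<theta> i) = 1"
    and f: "\<And>i. i \<in> I \<Longrightarrow> integrable M (f i)" "\<And>i x. i \<in> I \<Longrightarrow> 0 \<le> f i x"
  shows "integrable M (\<lambda>x. \<Prod>i\<in>I. f i x powr \<theta> i)"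
    and "(LINT x|M. (\<Prod>i\<in>I. f i x powr \<theta> i)) \<le> (\<Prod>i\<in>I. (LINT x|M. f i x) powr \<theta> i)"
proof -
  have [measurable]: "f i \<in> borel_measurable M" if "i \<in> I" for i
    using f(1)[OF that] by simp
  have meas: "(\<lambda>x. \<Prod>i\<in>I. f i x powr \<theta> i) \<in> borel_measurable M" by measurable
  show int: "integrable M (\<lambda>x. \<Prod>i\<in>I. f i x powr \<theta> i)"
  proof (rule Bochner_Integration.integrable_bound)
    show "integrable M (\<lambda>x. \<Sum>i\<in>I. \<theta> i * f i x)"
      using f(1) by (intro Bochner_Integration.integrable_sum integrable_mult_right) auto
    show "AE x in M. norm (\<Prod>i\<in>I. f i x powr \<theta> i) \<le> norm (\<Sum>i\<in>I. \<theta> i * f i x)"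
      using weighted_arith_geo_mean[OF I(1) f(2) I(2,3)] I f
      by (intro AE_I2) (simp add: prod_nonneg abs_of_nonneg sum_nonneg)
  qed fact
  show "(LINT x|M. (\<Prod>i\<in>I. f i x powr \<theta> i)) \<le> (\<Prod>i\<in>I. (LINT x|M. f i x) powr \<theta> i)"
  proof (cases "\<exists>i\<in>I. (LINT x|M. f i x) = 0")
    case True
    then obtain j where j: "j \<in> I" "(LINT x|M. f j x) = 0" by blast
    have "AE x in M. f j x = 0"
      using integral_nonneg_eq_0_iff_AE[OF f(1)[OF j(1)]] f(2)[OF j(1)] j(2) by auto
    then have "AE x in M. (\<Prod>i\<in>I. f i x powr \<theta> i) = 0"
      by eventually_elim (use I(1) j(1) in \<open>auto intro!: prod_zero\<close>)
    then have "(LINT x|M. (\<Prod>i\<in>I. f i x powr \<theta> i)) = 0"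
      using meas by (simp add: integral_eq_zero_AE)
    then show ?thesis by (simp add: prod_nonneg)
  next
    case False
    define c where "c i = (LINT x|M. f i x)" for i
    have c: "c i > 0" if "i \<in> I" for i
    proof -
      have "c i \<ge> 0" unfolding c_def by (intro Bochner_Integration.integral_nonneg f(2) that)
      moreover have "c i \<noteq> 0" using False that unfolding c_def by blast
      ultimately show ?thesis by simp
    qed
    have "(LINT x|M. (\<Prod>i\<in>I. f i x powr \<theta> i) / (\<Prod>i\<in>I. c i powr \<theta> i)) \<le> (LINT x|M. (\<Sum>i\<in>I. \<theta> i * (f i x / c i)))"
    proof (rule integral_mono)
      show "integrable M (\<lambda>x. (\<Prod>i\<in>I. f i x powr \<theta> i) / (\<Prod>i\<in>I. c i powr \<theta> i))"
        using int by simp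
      show "integrable M (\<lambda>x. \<Sum>i\<in>I. \<theta> i * (f i x / c i))"
        using f(1) by (intro Bochner_Integration.integrable_sum integrable_mult_right) auto
      show "(\<Prod>i\<in>I. f i x powr \<theta> i) / (\<Prod>i\<in>I. c i powr \<theta> i) \<le> (\<Sum>i\<in>I. \<theta> i * (f i x / c i))" for x
      proof -
        have "(\<Prod>i\<in>I. f i x powr \<theta> i) / (\<Prod>i\<in>I. c i powr \<theta> i) = (\<Prod>i\<in>I. (f i x / c i) powr \<theta> i)"
          unfolding prod_dividef[symmetric] using c f(2)
          by (intro prod.cong) (auto simp: powr_divide less_imp_le)
        also have "\<dots> \<le> (\<Sum>i\<in>I. \<theta> i * (f i x / c i))"
          using I f(2) c by (intro weighted_arith_geo_mean) (auto simp: less_imp_le)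
        finally show ?thesis .
      qed
    qed
    also have "\<dots> = (\<Sum>i\<in>I. LINT x|M. \<theta> i * (f i x / c i))"
      using f(1) by (intro Bochner_Integration.integral_sum integrable_mult_right) auto
    also have "\<dots> = (\<Sum>i\<in>I. \<theta> i)"
    proof (rule sum.cong)
      show "(LINT x|M. \<theta> i * (f i x / c i)) = \<theta> i" if "i \<in> I" for i
        using c[OF that] by (simp add: c_def[symmetric])
    qed simp
    also have "\<dots> = 1" by (rule I(3))
    finally have "(LINT x|M. (\<Prod>i\<in>I. f i x powr \<theta> i)) / (\<Prod>i\<in>I. c i powr \<theta> i) \<le> 1"
      by simp
    moreover have "0 < (\<Prod>i\<in>I. c i powr \<theta> i)"
      using c by (force intro!: prod_pos)
    ultimately show ?thesis
      by (simp add: divide_le_eq c_def[symmetric])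
  qed
qed

lemma lborel_distr_reflect:
  fixes t :: "'a::euclidean_space"
  shows "distr lborel borel (\<lambda>s. t - s) = lborel"
  using lborel_affine[of "-1" t] by (simp add: density_1)

lemma lborel_distr_translate:
  fixes s :: "'a::euclidean_space"
  shows "distr lborel borel (\<lambda>t. t - s) = lborel"
  using lborel_affine[of 1 "- s"] by (simp add: density_1)

lemma AE_lborel_reflect:
  fixes t :: "'a::euclidean_space"
  assumes "AE x in lborel. P x"
  shows "AE s in lborel. P (t - s)"
proof (rule AE_distrD[where M' = borel and f = "\<lambda>s. t - s"])
  show "AE x in distr lborel borel (\<lambda>s. t - s). P x"
    unfolding lborel_distr_reflect by fact
qed measurable

lemma lborel_integral_translate:
  fixes g :: "'a::euclidean_space \<Rightarrow> real"
  assumes [measurable]: "g \<in> borel_measurable borel" and "integrable lborel g"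
  shows "integrable lborel (\<lambda>t. g (t - s))" and "(LINT t|lborel. g (t - s)) = (LINT t|lborel. g t)"
proof -
  note d = lborel_distr_translate
  show "integrable lborel (\<lambda>t. g (t - s))"
    using assms(2) integrable_distr_eq[of "\<lambda>t. t - s" lborel borel g] by (simp add: d)
  show "(LINT t|lborel. g (t - s)) = (LINT t|lborel. g t)"
    using integral_distr[of "\<lambda>t. t - s" lborel borel g] by (simp add: d)
qed

lemma convolution_integrable:
  fixes u v :: "'a::euclidean_space \<Rightarrow> real"
  assumes [measurable]: "u \<in> borel_measurable borel" "v \<in> borel_measurable borel"
    and u: "integrable lborel u" "\<And>x. 0 \<le> u x" and v: "integrable lborel v" "\<And>x. 0 \<le> v x"
  shows "AE t in lborel. integrable lborel (\<lambda>s. u (t - s) * v s)"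
    and "integrable lborel (\<lambda>t. LINT s|lborel. u (t - s) * v s)"
    and "(LINT t|lborel. LINT s|lborel. u (t - s) * v s) = (LINT x|lborel. u x) * (LINT x|lborel. v x)"
proof -
  note tr = lborel_integral_translate[OF assms(1) u(1)]
  have int: "integrable (lborel \<Otimes>\<^sub>M lborel) (\<lambda>(s, t). u (t - s) * v s)"
  proof (rule lborel_pair.Fubini_integrable)
    show "(\<lambda>(s, t). u (t - s) * v s) \<in> borel_measurable (lborel \<Otimes>\<^sub>M lborel)"
      by measurable
    have "(\<lambda>s. LINT t|lborel. norm (case (s, t) of (s, t) \<Rightarrow> u (t - s) * v s))
        = (\<lambda>s. (LINT x|lborel. u x) * v s)"
      using u(2) v(2) tr(2) by (simp add: abs_mult)
    then show "integrable lborel (\<lambda>s. LINT t|lborel. norm (case (s, t) of (s, t) \<Rightarrow> u (t - s) * v s))"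
      using v(1) by simp
    show "AE s in lborel. integrable lborel (\<lambda>t. case (s, t) of (s, t) \<Rightarrow> u (t - s) * v s)"
      using tr(1) by simp
  qed
  then have int': "integrable (lborel \<Otimes>\<^sub>M lborel) (\<lambda>(t, s). u (t - s) * v s)"
    using lborel_pair.integrable_product_swap[OF int] by (simp add: case_prod_beta')
  show "AE t in lborel. integrable lborel (\<lambda>s. u (t - s) * v s)"
    using lborel_pair.AE_integrable_fst'[OF int'] by simp
  show "integrable lborel (\<lambda>t. LINT s|lborel. u (t - s) * v s)"
    using lborel_pair.integrable_fst'[OF int'] by simp
  have "(LINT t|lborel. LINT s|lborel. u (t - s) * v s) = (LINT s|lborel. LINT t|lborel. u (t - s) * v s)"
    using lborel_pair.Fubini_integral[OF int] .
  also have "\<dots> = (LINT x|lborel. u x) * (LINT x|lborel. v x)"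
    using tr(2) by simp
  finally show "(LINT t|lborel. LINT s|lborel. u (t - s) * v s) = (LINT x|lborel. u x) * (LINT x|lborel. v x)" .
qed

text \<open>Hoelder's inequality with weights \<open>\<rho>\<close>, \<open>1/p - \<rho>\<close>, \<open>1/q - \<rho>\<close> for the factorisation of \<open>u v\<close> into
  \<open>(u\<^sup>p v\<^sup>q) powr \<rho>\<close>, \<open>(u\<^sup>p) powr (1/p - \<rho>)\<close> and \<open>(v\<^sup>q) powr (1/q - \<rho>)\<close>; the relation between the exponents
  says that the weights add up to 1. Here \<open>\<rho>\<close> stands for \<open>1/r\<close> and may be 0. Only the first of
  the three integrals on the right depends on \<open>t\<close>, and it is a convolution of integrable functions.\<close>

lemma Young_pointwise:
  fixes u v :: "'a::euclidean_space \<Rightarrow> real" and p q \<rho> :: real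
  assumes pq: "p \<ge> 1" "q \<ge> 1" "\<rho> \<ge> 0" "1 + \<rho> = 1 / q + 1 / p"
    and [measurable]: "u \<in> borel_measurable borel" "v \<in> borel_measurable borel"
    and nonneg: "\<And>x. 0 \<le> u x" "\<And>x. 0 \<le> v x"
    and int: "integrable lborel (\<lambda>x. u x powr p)" "integrable lborel (\<lambda>x. v x powr q)"
  shows "AE t in lborel. integrable lborel (\<lambda>s. u (t - s) * v s) \<and>
    (LINT s|lborel. u (t - s) * v s) \<le> (LINT s|lborel. u (t - s) powr p * v s powr q) powr \<rho>
      * (LINT x|lborel. u x powr p) powr (1 / p - \<rho>) * (LINT x|lborel. v x powr q) powr (1 / q - \<rho>)"
proof -
  have "AE t in lborel. integrable lborel (\<lambda>s. u (t - s) powr p * v s powr q)"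
    by (rule convolution_integrable) (use int in auto)
  then show ?thesis
  proof eventually_elim
    case (elim t)
    have d: "distr lborel borel (\<lambda>s. t - s) = (lborel :: 'a measure)"
      by (rule lborel_distr_reflect)
    have ut: "integrable lborel (\<lambda>s. u (t - s) powr p)"
      using int(1) integrable_distr_eq[of "\<lambda>s. t - s" lborel borel "\<lambda>x. u x powr p"] by (simp add: d)
    have ut_eq: "(LINT s|lborel. u (t - s) powr p) = (LINT x|lborel. u x powr p)"
      using integral_distr[of "\<lambda>s. t - s" lborel borel "\<lambda>x. u x powr p"] by (simp add: d)
    define F where "F i s = [u (t - s) powr p * v s powr q, u (t - s) powr p, v s powr q] ! i" for i s
    define \<theta> where "\<theta> i = [\<rho>, 1 / p - \<rho>, 1 / q - \<rho>] ! i" for i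
    have three: "{..<3} = {0, 1, 2 :: nat}" by auto
    have "\<rho> \<le> 1 / p" "\<rho> \<le> 1 / q"
    proof -
      have "1 / p \<le> 1" "1 / q \<le> 1" using pq by simp_all
      then show "\<rho> \<le> 1 / p" "\<rho> \<le> 1 / q" using pq(4) by linarith+
    qed
    then have \<theta>: "0 \<le> \<theta> i" if "i \<in> {0, 1, 2}" for i
      using that pq by (auto simp: \<theta>_def)
    have \<theta>1: "(\<Sum>i\<in>{0, 1, 2}. \<theta> i) = 1"
      using pq by (simp add: \<theta>_def)
    have F: "integrable lborel (F i)" if "i \<in> {0, 1, 2}" for i
      using that elim ut int(2) by (auto simp: F_def[abs_def])
    have F0: "0 \<le> F i s" if "i \<in> {0, 1, 2}" for i s
      using that by (auto simp: F_def)
    have prod_eq: "(\<Prod>i\<in>{0, 1, 2}. F i s powr \<theta> i) = u (t - s) * v s" for s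
    proof (cases "u (t - s) = 0 \<or> v s = 0")
      case False
      then have pos: "u (t - s) > 0" "v s > 0" using nonneg by (auto simp: less_le)
      have e: "p * \<rho> + p * (1 / p - \<rho>) = 1" "q * \<rho> + q * (1 / q - \<rho>) = 1"
        using pq by (simp_all add: field_simps)
      have "(\<Prod>i\<in>{0, 1, 2}. F i s powr \<theta> i)
          = u (t - s) powr (p * \<rho> + p * (1 / p - \<rho>)) * v s powr (q * \<rho> + q * (1 / q - \<rho>))"
        using pos unfolding powr_add by (simp add: F_def \<theta>_def powr_mult powr_powr)
      then show ?thesis unfolding e using pos by simp
    qed (auto simp: F_def)
    have "integrable lborel (\<lambda>s. u (t - s) * v s)"
      using Hoelder_finite_family(1)[of "{0, 1, 2}" \<theta> lborel F] \<theta> \<theta>1 F F0 unfolding prod_eq by blast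
    moreover have "(LINT s|lborel. u (t - s) * v s) \<le> (\<Prod>i\<in>{0, 1, 2}. (LINT s|lborel. F i s) powr \<theta> i)"
      using Hoelder_finite_family(2)[of "{0, 1, 2}" \<theta> lborel F] \<theta> \<theta>1 F F0 unfolding prod_eq by blast
    ultimately show ?case
      by (simp add: F_def \<theta>_def ut_eq mult_ac)
  qed
qed

lemma lebesgue_reflect_measurable:
  fixes t :: "'a::euclidean_space"
  shows "(\<lambda>s. t - s) \<in> lebesgue \<rightarrow>\<^sub>M lebesgue"
proof -
  have "(\<lambda>x :: 'a. t + (\<Sum>j\<in>Basis. (- 1 * (x \<bullet> j)) *\<^sub>R j)) \<in> lebesgue \<rightarrow>\<^sub>M lebesgue"
    by (rule lebesgue_affine_measurable[of "\<lambda>_. - 1"]) simp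
  then show ?thesis
    by (simp add: sum_negf euclidean_representation)
qed

text \<open>Fubini's theorem lives on the product of Borel measures, so a Lebesgue measurable function is
  first replaced by a Borel measurable one.\<close>

lemma lebesgue_complex_AE_borel:
  fixes f :: "'a::euclidean_space \<Rightarrow> complex"
  assumes [measurable]: "f \<in> borel_measurable lebesgue"
  obtains g where "g \<in> borel_measurable borel" "AE x in lborel. f x = g x"
proof -
  have Re: "(\<lambda>x. Re (f x)) \<in> borel_measurable lebesgue"
    and Im: "(\<lambda>x. Im (f x)) \<in> borel_measurable lebesgue"
    by measurable
  obtain a where a: "a \<in> borel_measurable lborel" "AE x in lborel. Re (f x) = a x"
    using completion_ex_borel_measurable_real[OF Re] by blast
  obtain b where b: "b \<in> borel_measurable lborel" "AE x in lborel. Im (f x) = b x"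
    using completion_ex_borel_measurable_real[OF Im] by blast
  show ?thesis
  proof
    have [measurable]: "a \<in> borel_measurable borel" "b \<in> borel_measurable borel"
      using a(1) b(1) by simp_all
    show "(\<lambda>x. Complex (a x) (b x)) \<in> borel_measurable borel"
      unfolding Complex_eq by measurable
    show "AE x in lborel. f x = Complex (a x) (b x)"
      using a(2) b(2) by eventually_elim (simp add: complex_eq_iff)
  qed
qed

text \<open>For finite \<open>r\<close>, the pointwise estimate raised to the power \<open>r\<close> is integrated, and Fubini's theorem
  evaluates the integral of the convolution as a product; for \<open>r = \<infinity>\<close> the pointwise estimate is already
  uniform. The kernel is bounded through a majorant \<open>v\<close>, so that only the norm of \<open>v\<close>
  has to be computed.\<close>

lemma Young_Lp:
  fixes f :: "real ^ 'n \<Rightarrow> complex" and \<kappa> v :: "real ^ 'n \<Rightarrow> real" and p q :: real and r :: ennreal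
  assumes pq: "p \<ge> 1" "q \<ge> 1" "r \<ge> 1" "1 + enn2real (1 / r) = 1 / q + 1 / p"
    and f: "f \<in> Lp_space (ennreal p)"
    and [measurable]: "\<kappa> \<in> borel_measurable borel" "v \<in> borel_measurable borel"
    and v: "\<And>x. \<bar>\<kappa> x\<bar> \<le> v x" "integrable lborel (\<lambda>x. v x powr q)"
  defines "T \<equiv> \<lambda>t. LINT s|lebesgue. f (t - s) * complex_of_real (\<kappa> s)"
  shows "AE t in lebesgue. integrable lebesgue (\<lambda>s. f (t - s) * complex_of_real (\<kappa> s))"
    and "T \<in> Lp_space r"
    and "Lp_norm r T \<le> (LINT x|lborel. v x powr q) powr (1 / q) * Lp_norm (ennreal p) f"
proof -
  have p: "enn2real (ennreal p) = p" "ennreal p \<noteq> top" using pq by simp_all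
  have v0: "0 \<le> v x" for x using v(1)[of x] by linarith
  have f_meas [measurable]: "f \<in> borel_measurable lebesgue"
    and f_int: "integrable lebesgue (\<lambda>x. norm (f x) powr p)"
    using f p by (simp_all add: Lp_space_def)
  obtain g where g_meas [measurable]: "g \<in> borel_measurable borel" and fg: "AE x in lborel. f x = g x"
    using lebesgue_complex_AE_borel[OF f_meas] by blast
  have g_leb [measurable]: "g \<in> borel_measurable lebesgue"
    using g_meas by (intro measurable_completion) simp
  define A where "A = (LINT x|lborel. norm (g x) powr p)"
  define B where "B = (LINT x|lborel. v x powr q)"
  define \<rho> where "\<rho> = enn2real (1 / r)"
  have \<rho>0: "\<rho> \<ge> 0" by (simp add: \<rho>_def)
  have gp_meas: "(\<lambda>x. norm (g x) powr p) \<in> borel_measurable lborel" by simp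
  have ae_p: "AE x in lebesgue. norm (f x) powr p = norm (g x) powr p"
    using AE_completion[OF fg] by eventually_elim simp
  have "integrable lebesgue (\<lambda>x. norm (g x) powr p)"
    using f_int ae_p by (subst integrable_cong_AE[symmetric]) auto
  then have g_int: "integrable lborel (\<lambda>x. norm (g x) powr p)"
    using integrable_completion[OF gp_meas] by simp
  have f_norm: "Lp_norm (ennreal p) f = A powr (1 / p)"
  proof -
    have "(LINT x|lebesgue. norm (f x) powr p) = (LINT x|lebesgue. norm (g x) powr p)"
      using ae_p by (intro integral_cong_AE) auto
    also have "\<dots> = A"
      unfolding A_def by (rule integral_completion[OF gp_meas])
    finally show ?thesis by (simp add: Lp_norm_def p)
  qed
  have AB: "A \<ge> 0" "B \<ge> 0" unfolding A_def B_def by (auto intro: Bochner_Integration.integral_nonneg)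

  \<comment> \<open>Reflection preserves null sets, so for every single \<open>t\<close>, not only almost every one, the
    integral does not change when \<open>f\<close> is replaced by \<open>g\<close>.\<close>
  have g\<kappa>_meas [measurable]: "(\<lambda>s. g (t - s) * complex_of_real (\<kappa> s)) \<in> borel_measurable lborel" for t
    by measurable
  have ae_s: "AE s in lebesgue. f (t - s) * complex_of_real (\<kappa> s) = g (t - s) * complex_of_real (\<kappa> s)" for t
    using AE_completion[OF AE_lborel_reflect[OF fg, of t]] by eventually_elim simp
  have f\<kappa>_meas: "(\<lambda>s. f (t - s) * complex_of_real (\<kappa> s)) \<in> borel_measurable lebesgue" for t
  proof -
    have [measurable]: "(\<lambda>s. f (t - s)) \<in> borel_measurable lebesgue"
      by (rule measurable_compose[OF lebesgue_reflect_measurable f_meas])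
    have [measurable]: "\<kappa> \<in> borel_measurable lebesgue"
      using assms(6) by (intro measurable_completion) simp
    show ?thesis by measurable
  qed
  have int_iff: "integrable lebesgue (\<lambda>s. f (t - s) * complex_of_real (\<kappa> s))
      \<longleftrightarrow> integrable lborel (\<lambda>s. g (t - s) * complex_of_real (\<kappa> s))" for t
    using integrable_cong_AE[OF f\<kappa>_meas measurable_completion[OF g\<kappa>_meas] ae_s]
      integrable_completion[OF g\<kappa>_meas] by simp
  have T_eq: "T t = (LINT s|lborel. g (t - s) * complex_of_real (\<kappa> s))" for t
    unfolding T_def
    using integral_cong_AE[OF f\<kappa>_meas measurable_completion[OF g\<kappa>_meas] ae_s]
      integral_completion[OF g\<kappa>_meas] by simp
  have T_meas: "T \<in> borel_measurable lborel"
    unfolding T_eq[abs_def] by measurable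
  have T_leb [measurable]: "T \<in> borel_measurable lebesgue"
    using T_meas by (rule measurable_completion)

  define H where "H t = (LINT s|lborel. norm (g (t - s)) powr p * v s powr q)" for t
  have H: "integrable lborel H" "(LINT t|lborel. H t) = A * B"
    unfolding H_def[abs_def] A_def B_def
    by (rule convolution_integrable; use g_int v in simp)+
  have H0: "H t \<ge> 0" for t unfolding H_def by (intro Bochner_Integration.integral_nonneg) simp
  define c where "c = A powr (1 / p - \<rho>) * B powr (1 / q - \<rho>)"
  have c0: "c \<ge> 0" by (simp add: c_def)
  have "AE t in lborel. integrable lborel (\<lambda>s. norm (g (t - s)) * v s) \<and>
      (LINT s|lborel. norm (g (t - s)) * v s) \<le> H t powr \<rho> * A powr (1 / p - \<rho>) * B powr (1 / q - \<rho>)"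
    unfolding H_def A_def B_def
    using pq v v0 g_int \<rho>0 by (intro Young_pointwise) (auto simp: \<rho>_def)
  then have key: "AE t in lborel. integrable lborel (\<lambda>s. g (t - s) * complex_of_real (\<kappa> s)) \<and>
      norm (T t) \<le> H t powr \<rho> * c"
  proof eventually_elim
    case (elim t)
    have le: "norm (g (t - s) * complex_of_real (\<kappa> s)) \<le> norm (g (t - s)) * v s" for s
      using v(1) by (simp add: norm_mult mult_left_mono)
    have gi: "integrable lborel (\<lambda>s. g (t - s) * complex_of_real (\<kappa> s))"
      using elim by (intro Bochner_Integration.integrable_bound[OF _ g\<kappa>_meas, of "\<lambda>s. norm (g (t - s)) * v s"])
        (use le v0 in \<open>auto simp: abs_mult\<close>)
    have "norm (T t) \<le> (LINT s|lborel. norm (g (t - s)) * v s)"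
    proof -
      have "norm (T t) \<le> (LINT s|lborel. norm (g (t - s) * complex_of_real (\<kappa> s)))"
        unfolding T_eq by (rule integral_norm_bound)
      also have "\<dots> \<le> (LINT s|lborel. norm (g (t - s)) * v s)"
        using elim le by (intro integral_mono integrable_norm gi) auto
      finally show ?thesis .
    qed
    with gi show ?case using elim by (simp add: c_def mult.assoc)
  qed
  show "AE t in lebesgue. integrable lebesgue (\<lambda>s. f (t - s) * complex_of_real (\<kappa> s))"
    unfolding int_iff using AE_completion[OF key] by eventually_elim simp
  have key': "AE t in lborel. norm (T t) \<le> H t powr \<rho> * c"
    using key by eventually_elim simp
  have "T \<in> Lp_space r \<and> Lp_norm r T \<le> A powr (1 / p) * B powr (1 / q)"
  proof (cases "r = top")
    case True
    then have "\<rho> = 0" by (simp add: \<rho>_def)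
    have "AE t in lebesgue. ereal (norm (T t)) \<le> ereal c"
      using AE_completion[OF key']
      by eventually_elim (use c0 \<open>\<rho> = 0\<close> in \<open>auto split: if_splits intro: order_trans\<close>)
    then have le: "esssup lebesgue (\<lambda>t. ereal (norm (T t))) \<le> ereal c"
      by (intro esssup_I) auto
    then have "real_of_ereal (esssup lebesgue (\<lambda>t. ereal (norm (T t)))) \<le> c"
      using c0 by (cases "esssup lebesgue (\<lambda>t. ereal (norm (T t)))") auto
    moreover have "esssup lebesgue (\<lambda>t. ereal (norm (T t))) < \<infinity>"
      using le by (rule order_le_less_trans) simp
    ultimately show ?thesis
      using True \<open>\<rho> = 0\<close> by (simp add: Lp_space_def Lp_norm_def c_def)
  next
    case False
    define r' where "r' = enn2real r"
    have r: "r = ennreal r'" using False by (simp add: r'_def less_top)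
    have r': "r' \<ge> 1" using pq(3) unfolding r by simp
    have \<rho>: "\<rho> = 1 / r'" unfolding \<rho>_def r using r' by (simp flip: ennreal_1 add: divide_ennreal)
    have "AE t in lborel. norm (T t) powr r' \<le> c powr r' * H t"
      using key'
    proof eventually_elim
      case (elim t)
      have "norm (T t) powr r' \<le> (H t powr \<rho> * c) powr r'"
        using elim r' by (intro powr_mono2) auto
      also have "\<dots> = c powr r' * H t"
        using c0 H0[of t] r' by (simp add: powr_mult powr_powr \<rho>)
      finally show ?case .
    qed
    note bound = this
    have Tr_meas: "(\<lambda>t. norm (T t) powr r') \<in> borel_measurable lborel"
      using T_meas by simp
    have int: "integrable lborel (\<lambda>t. norm (T t) powr r')"
      using H(1) Tr_meas
    proof (rule Bochner_Integration.integrable_bound[OF integrable_mult_right])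
      show "AE t in lborel. norm (norm (T t) powr r') \<le> norm (c powr r' * H t)"
        using bound by eventually_elim (use H0 in auto)
    qed
    have "(LINT t|lborel. norm (T t) powr r') \<le> (LINT t|lborel. c powr r' * H t)"
      using int H(1) bound by (intro integral_mono_AE) auto
    also have "\<dots> = c powr r' * (A * B)" using H by simp
    finally have "(LINT t|lborel. norm (T t) powr r') powr \<rho> \<le> (c powr r' * (A * B)) powr \<rho>"
      using \<rho>0 by (intro powr_mono2 Bochner_Integration.integral_nonneg) auto
    also have "\<dots> = c * (A powr \<rho> * B powr \<rho>)"
      using c0 AB r' by (simp add: powr_mult powr_powr \<rho>)
    also have "\<dots> = A powr (1 / p - \<rho> + \<rho>) * B powr (1 / q - \<rho> + \<rho>)"
      unfolding powr_add c_def by (simp add: mult_ac)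
    finally have "(LINT t|lborel. norm (T t) powr r') powr \<rho> \<le> A powr (1 / p) * B powr (1 / q)" by simp
    then show ?thesis
      using int integral_completion[OF Tr_meas] integrable_completion[OF Tr_meas] T_leb r'
      by (simp add: Lp_space_def Lp_norm_def r \<rho>)
  qed
  then show "T \<in> Lp_space r" "Lp_norm r T \<le> (LINT x|lborel. v x powr q) powr (1 / q) * Lp_norm (ennreal p) f"
    by (simp_all add: f_norm B_def mult.commute)
qed


section \<open>The norm estimate for the operator\<close>

lemma enn2real_one_divide:
  assumes "x \<ge> 1"
  shows "enn2real (1 / x) = 1 / enn2real x"
proof (cases x)
  case (real y)
  with assms have "y \<ge> 1" by (simp flip: ennreal_1)
  then show ?thesis using real by (simp add: divide_ennreal flip: ennreal_1)
qed simp

lemma one_less_enn2real: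
  assumes "x > 1" "x \<noteq> top"
  shows "enn2real x > 1"
proof (cases x)
  case (real y)
  then show ?thesis using assms(1) by (simp add: ennreal_less_iff flip: ennreal_1)
qed (use assms in simp)

lemma q0_exp_ge_1:
  assumes "n > 1" "-1 < \<alpha>" "\<alpha> \<le> (real n - 1) / 2"
  shows "q0_exp \<alpha> n \<ge> 1"
  using assms by (simp add: q0_exp_def field_simps)

text \<open>Since \<open>q > q\<^sub>0 \<ge> 1\<close> and \<open>p > 1\<close>, both reciprocals \<open>1/q\<close> and \<open>1/p\<close> are below 1, while they add up to at least 1.
  Hence neither \<open>p\<close> nor \<open>q\<close> is infinite, the relation is one between real numbers, and it can be solved
  for \<open>q\<close>, which gives \<open>q_exp\<close>.\<close>

lemma exponent_relation:
  assumes pqr: "p > 1" "q \<ge> 1" "r \<ge> 1" "1 + 1 / r = 1 / q + 1 / p"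
    and q: "q > ennreal q\<^sub>0" "q\<^sub>0 \<ge> 1"
  shows "p = ennreal (enn2real p)" "enn2real p > 1" "q_exp p r > q\<^sub>0"
    "1 + enn2real (1 / r) = 1 / q_exp p r + enn2real (1 / p)"
    "enn2real (1 / p) = 1 / enn2real p"
proof -
  define P Q S where "P = enn2real p" and "Q = enn2real q" and "S = enn2real r"
  have ge: "p \<ge> 1" "q \<ge> 1" "r \<ge> 1" using pqr by auto
  have fin: "1 / x < top" if "x \<ge> 1" for x :: ennreal
  proof (cases x)
    case (real y)
    then have "y \<ge> 1" using that by (simp flip: ennreal_1)
    then show ?thesis using real by (simp add: divide_ennreal flip: ennreal_1)
  qed simp
  have "enn2real (1 + 1 / r) = enn2real (1 / q + 1 / p)"
    using pqr(4) by simp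
  moreover have "enn2real (1 + 1 / r) = 1 + 1 / S"
    using fin[OF ge(3)] by (simp add: enn2real_plus enn2real_one_divide[OF ge(3)] S_def)
  moreover have "enn2real (1 / q + 1 / p) = 1 / Q + 1 / P"
    using fin[OF ge(1)] fin[OF ge(2)]
    by (simp add: enn2real_plus enn2real_one_divide[OF ge(1)] enn2real_one_divide[OF ge(2)] P_def Q_def)
  ultimately have rel: "1 + 1 / S = 1 / Q + 1 / P" by simp
  have S: "1 / S \<ge> 0" by (simp add: S_def)
  have "1 \<le> ennreal q\<^sub>0" using ennreal_leI[OF q(2)] by simp
  then have "q > 1" using q(1) by (rule order_le_less_trans)
  then have Q: "Q > 1" if "q \<noteq> top" unfolding Q_def using that by (rule one_less_enn2real)
  have P: "P > 1" if "p \<noteq> top" unfolding P_def using pqr(1) that by (rule one_less_enn2real)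
  have Q': "1 / Q < 1" using Q by (cases "q = top") (simp_all add: Q_def)
  have P': "1 / P < 1" using P by (cases "p = top") (simp_all add: P_def)
  have "p \<noteq> top"
  proof
    assume "p = top"
    then have "1 / P = 0" by (simp add: P_def)
    then show False using rel S Q' by linarith
  qed
  have "q \<noteq> top"
  proof
    assume "q = top"
    then have "1 / Q = 0" by (simp add: Q_def)
    then show False using rel S P' by linarith
  qed
  show "p = ennreal (enn2real p)" using \<open>p \<noteq> top\<close> by (simp add: less_top)
  show "enn2real p > 1" using P \<open>p \<noteq> top\<close> unfolding P_def by blast
  show "enn2real (1 / p) = 1 / enn2real p" using ge(1) by (rule enn2real_one_divide)
  have P1: "P > 1" and Q1: "Q > 1" using P Q \<open>p \<noteq> top\<close> \<open>q \<noteq> top\<close> by blast+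
  have "ennreal Q = q" unfolding Q_def using \<open>q \<noteq> top\<close> by (simp add: less_top)
  then have "ennreal q\<^sub>0 < ennreal Q" using q(1) by simp
  then have Qq0: "Q > q\<^sub>0" using q(2) by (simp add: ennreal_less_iff)
  have Qeq: "q_exp p r = Q"
  proof (cases "r = top")
    case True
    then have "1 / S = 0" by (simp add: S_def)
    then have "1 = 1 / Q + 1 / P" using rel by simp
    then have "Q * (P - 1) = P" using P1 Q1 by (simp add: field_simps)
    then have "P / (P - 1) = Q" using P1 by (simp add: divide_eq_eq)
    then show ?thesis unfolding q_exp_def Let_def P_def[symmetric] using True by simp
  next
    case False
    have "ennreal S = r" unfolding S_def using False by (simp add: less_top)
    then have "ennreal 1 \<le> ennreal S" using ge(3) by simp
    then have S1: "S \<ge> 1" by (simp add: S_def)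
    have "1 / Q = (P * S + P - S) / (P * S)" using rel P1 S1 by (simp add: field_simps)
    then have "P * S / (P * S + P - S) = Q" by (metis inverse_divide inverse_inverse_eq inverse_eq_divide)
    then show ?thesis unfolding q_exp_def Let_def P_def[symmetric] S_def[symmetric] using False by simp
  qed
  show "q_exp p r > q\<^sub>0" unfolding Qeq by (rule Qq0)
  show "1 + enn2real (1 / r) = 1 / q_exp p r + enn2real (1 / p)"
    unfolding Qeq enn2real_one_divide[OF ge(1)] enn2real_one_divide[OF ge(3)]
      P_def[symmetric] S_def[symmetric] by (rule rel)
qed

theorem theorem2p1:
  fixes \<alpha> R :: real
  assumes "CARD('n::finite) > 1"
    and "-1 < \<alpha>" and "\<alpha> \<le> (real CARD('n) - 1) / 2"
    and "R > 0"
  shows "\<exists>C>0. \<forall>(p::ennreal) (q::ennreal) (r::ennreal) (f :: real ^ 'n \<Rightarrow> complex).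
    p > 1 \<longrightarrow> f \<in> Lp_space p \<longrightarrow> q \<ge> 1 \<longrightarrow> r \<ge> 1 \<longrightarrow>
    1 + 1 / r = 1 / q + 1 / p \<longrightarrow>
    q > ennreal (q0_exp \<alpha> CARD('n)) \<longrightarrow> r > r0_exp \<alpha> CARD('n) p \<longrightarrow> p \<le> p0_exp \<alpha> CARD('n) \<longrightarrow>
      (AE t in lebesgue. integrable lebesgue (\<lambda>s. f (t - s) * complex_of_real (BR_kernel \<alpha> R s))) \<and>
      BR_op \<alpha> R f \<in> Lp_space r \<and>
      Lp_norm r (BR_op \<alpha> R f) \<le> C * W_factor \<alpha> CARD('n) R p r * Lp_norm p f"
proof -
  define q\<^sub>0 where "q\<^sub>0 = q0_exp \<alpha> CARD('n)"
  have q0: "q\<^sub>0 \<ge> 1" unfolding q\<^sub>0_def by (rule q0_exp_ge_1[OF assms(1-3)])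
  have nu: "0 \<le> \<alpha> + real CARD('n) / 2" using assms(1,2) by simp
  obtain A where A: "A > 0" and majorant: "\<And>R (z :: real ^ 'n). R > 0 \<Longrightarrow>
    \<bar>BR_kernel \<alpha> R z\<bar> \<le> A * R ^ CARD('n) * (1 + R * norm z) powr - (\<alpha> + (real CARD('n) + 1) / 2)"
    using BR_kernel_majorant[OF assms(2) nu] by blast
  have exponent: "\<alpha> + (real CARD('n) + 1) / 2 = real CARD('n) / q\<^sub>0"
    using assms(1,2) by (simp add: q\<^sub>0_def q0_exp_def)
  define v where "v z = A * R ^ CARD('n) * (1 + R * norm z) powr - (real CARD('n) / q\<^sub>0)" for z :: "real ^ 'n"
  define C where "C = A * max 1 (unit_ball_vol CARD('n)) * exp 1"
  have "C > 0" using A by (simp add: C_def)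
  moreover have "(AE t in lebesgue. integrable lebesgue (\<lambda>s. f (t - s) * complex_of_real (BR_kernel \<alpha> R s))) \<and>
      BR_op \<alpha> R f \<in> Lp_space r \<and>
      Lp_norm r (BR_op \<alpha> R f) \<le> C * W_factor \<alpha> CARD('n) R p r * Lp_norm p f"
    if p: "p > 1" and f: "f \<in> Lp_space p" and q: "q \<ge> 1" and r: "r \<ge> 1"
      and rel: "1 + 1 / r = 1 / q + 1 / p" and qq: "q > ennreal (q0_exp \<alpha> CARD('n))"
    for p q r :: ennreal and f :: "real ^ 'n \<Rightarrow> complex"
  proof -
    define Q where "Q = q_exp p r"
    note E = exponent_relation[OF p q r rel qq q0[unfolded q\<^sub>0_def], folded q\<^sub>0_def Q_def]
    have Q1: "Q \<ge> 1" using E(3) q0 by simp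
    have f': "f \<in> Lp_space (ennreal (enn2real p))" using f E(1) by simp
    have vm: "v \<in> borel_measurable borel" unfolding v_def[abs_def] by measurable
    have vle: "\<bar>BR_kernel \<alpha> R z\<bar> \<le> v z" for z :: "real ^ 'n"
      using majorant[OF assms(4), of z] unfolding v_def exponent .
    have rel': "1 + enn2real (1 / r) = 1 / Q + 1 / enn2real p" using E(4,5) by simp
    have vint: "integrable lborel (\<lambda>z. v z powr Q)"
      unfolding v_def using A assms(4) E(3) q0 by (rule BR_majorant_norm(1))
    have vnorm: "(LINT z|lborel. v z powr Q) powr (1 / Q)
        \<le> C * R powr (CARD('n) * (1 - 1 / Q)) * (Q - q\<^sub>0) powr - (1 / Q)"
      unfolding v_def C_def using A assms(4) E(3) q0 by (rule BR_majorant_norm(2))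
    also have "\<dots> = C * W_factor \<alpha> CARD('n) R p r"
    proof -
      have e: "enn2real (1 / p) - enn2real (1 / r) = 1 - 1 / Q"
        "enn2real (1 / p) - 1 - enn2real (1 / r) = - (1 / Q)" using E(4) by simp_all
      show ?thesis
        unfolding W_factor_def Q_def[symmetric] q\<^sub>0_def[symmetric] e by (simp add: mult.assoc)
    qed
    finally have norm: "(LINT z|lborel. v z powr Q) powr (1 / Q) \<le> C * W_factor \<alpha> CARD('n) R p r" .
    note Y = Young_Lp[OF less_imp_le[OF E(2)] Q1 r rel' f'
        borel_measurable_BR_kernel[OF nu assms(4)] vm vle vint, folded BR_op_def]
    have "Lp_norm p f \<ge> 0" using E(1) by (metis Lp_norm_def powr_ge_zero ennreal_neq_top)
    then have "(LINT z|lborel. v z powr Q) powr (1 / Q) * Lp_norm p f \<le> C * W_factor \<alpha> CARD('n) R p r * Lp_norm p f"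
      by (rule mult_right_mono[OF norm])
    with Y E(1) show ?thesis by (auto simp: BR_op_def[abs_def])
  qed
  ultimately show ?thesis by blast
qed

end
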